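(* Let $\Gamma^{(1)}$ be one of the affine $ADE$ graphs (with at most one edge between two vertices and no loops), whose Perron--Frobenius eigenvalue is $\bar\kappa_{\Gamma^{(1)}}=2$. The parametrization $x=f(z)=\frac{z}{1-z}$ satisfies, with $x=f(z)$, $x'=f(z')$, $x''=f(z'')$, $z''=z'-z$ (for generic $z,z'$), $$x''=\frac{x'-x}{1+\bar\kappa_{\Gamma^{(1)}}x+xx'},$$ and $\check R(z,a):=\mathrm{id}+\frac{z}{1-z}T_{\Gamma^{(1)}}(a)$ satisfies the dynamical Yang--Baxter equation: for all vertices $a$ of $\Gamma^{(1)}$ and generic $z,w\in\mathbb{C}$, $$\check R^{(23)}(z-w,ah^{(1)})\,\check R^{(12)}(z,a)\,\check R^{(23)}(w,ah^{(1)})=\check R^{(12)}(w,a)\,\check R^{(23)}(z,ah^{(1)})\,\check R^{(12)}(z-w,a).$$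
   Context: Write $\Gamma=\Gamma^{(1)}$. The groupoid $\pi(\Gamma)$ has the vertices of $\Gamma$ as objects; each unoriented edge gives two mutually inverse arrows (one in each direction), and the arrows of $\pi(\Gamma)$ are those formed by their compositions (the free groupoid on the graph); $s,t$ denote source and target. For adjacent vertices $d,a$ let $(d,a)$ be the edge arrow from $d$ to $a$. Let $V$ be the $\pi(\Gamma)$-graded vector space with $V_{(d,a)}=\mathbb{C}e_{(d,a)}$ for all adjacent $d,a$ and $V_\alpha=0$ for other arrows. Tensor products: $(V\otimes W)_\gamma=\bigoplus_{\beta\circ\alpha=\gamma}V_\alpha\otimes W_\beta$. Let $Y$ be the adjacency matrix of $\Gamma$ and $(S_i)$ its Perron--Frobenius eigenvector (positive entries, eigenvalue $2$). $T_\Gamma(d)$ acts on the source fiber $\bigoplus_{\alpha\in s^{-1}(d)}(V\otimes V)_\alpha$ by $$T_\Gamma(d)(e_{(d,a)}\otimes e_{(a,d)})=\sum_{c\text{ adjacent to }d}\sqrt{\tfrac{S_aS_c}{S_dS_d}}\;e_{(d,c)}\otimes e_{(c,d)},\qquad T_\Gamma(d)(e_{(d,a)}\otimes e_{(a,b)})=0\ (b\ne d).$$ For a family $X(a)\in\bigoplus_{\alpha\in s^{-1}(a)}\mathrm{End}_{\mathbb{C}}((V\otimes V)_\alpha)$ and $u\otimes v\otimes w\in V_{\alpha_1}\otimes V_{\alpha_2}\otimes V_{\alpha_3}$ with composable arrows and $s(\alpha_1)=a$, set $X^{(12)}(a)(u\otimes v\otimes w)=X(a)(u\otimes v)\otimes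 w$ and $X^{(23)}(ah^{(1)})(u\otimes v\otimes w)=u\otimes X(t(\alpha_1))(v\otimes w)$. *)

theory Defs
  imports "HOL-Analysis.Analysis"
begin

section \<open>Affine ADE graphs\<close>

text \<open>
  A finite simple graph is an adjacency relation on a finite vertex type. The affine Dynkin graphs are
  given by edge lists on the vertices \<open>0, \<dots>, N - 1\<close>. The family \<open>A\<close> starts at \<open>n = 2\<close>:
  for \<open>n = 1\<close> there is a double edge and for \<open>n = 0\<close> a loop.
\<close>

inductive affine_ADE_model :: "nat \<Rightarrow> (nat \<times> nat) set \<Rightarrow> bool" where
  type_A: "n \<ge> 2 \<Longrightarrow> affine_ADE_model (n + 1) ({(i, i + 1) | i. i < n} \<union> {(n, 0)})"
| type_D: "n \<ge> 4 \<Longrightarrow> affine_ADE_model (n + 1)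
        ({(0, 2)} \<union> {(i, i + 1) | i. 1 \<le> i \<and> i \<le> n - 2} \<union> {(n - 2, n)})"
| type_E6: "affine_ADE_model 7 {(0,1), (1,2), (2,3), (3,4), (2,5), (5,6)}"
| type_E7: "affine_ADE_model 8 {(0,1), (1,2), (2,3), (3,4), (4,5), (5,6), (3,7)}"
| type_E8: "affine_ADE_model 9 {(0,1), (1,2), (2,3), (3,4), (4,5), (5,6), (6,7), (2,8)}"

definition affine_ADE :: "('v::finite \<Rightarrow> 'v \<Rightarrow> bool) \<Rightarrow> bool" where
  "affine_ADE adj \<longleftrightarrow>
     (\<exists>N E f. affine_ADE_model N E \<and> bij_betw f UNIV {..<N} \<and>
        (\<forall>x y. adj x y \<longleftrightarrow> (f x, f y) \<in> E \<or> (f y, f x) \<in> E))"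


section \<open>Perron--Frobenius data\<close>

definition adjacency_matrix :: "('v::finite \<Rightarrow> 'v \<Rightarrow> bool) \<Rightarrow> real ^ 'v ^ 'v" where
  "adjacency_matrix adj = (\<chi> i j. of_bool (adj i j))"

text \<open>The largest modulus of a complex eigenvalue.\<close>

definition perron_frobenius_eigenvalue :: "real ^ 'n ^ 'n \<Rightarrow> real" where
  "perron_frobenius_eigenvalue A =
     (GREATEST r. \<exists>k v. v \<noteq> 0 \<and> map_matrix complex_of_real A *v v = k *s v \<and> r = cmod k)"

definition perron_frobenius_eigenvector :: "real ^ 'n ^ 'n \<Rightarrow> real ^ 'n \<Rightarrow> bool" where
  "perron_frobenius_eigenvector A S \<longleftrightarrow>
     (\<forall>i. S $ i > 0) \<and> A *v S = perron_frobenius_eigenvalue A *s S"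


section \<open>The free groupoid on a graph\<close>

text \<open>
  A walk is its nonempty list of vertices, which determines the edges since the graph is simple.
  An arrow is the class of a walk modulo cancellation of an edge followed by its reverse.
\<close>

definition is_walk :: "('v \<Rightarrow> 'v \<Rightarrow> bool) \<Rightarrow> 'v list \<Rightarrow> bool" where
  "is_walk adj p \<longleftrightarrow> p \<noteq> [] \<and> successively adj p"

inductive homotopic :: "('v \<Rightarrow> 'v \<Rightarrow> bool) \<Rightarrow> 'v list \<Rightarrow> 'v list \<Rightarrow> bool" for adj where
  hom_refl: "is_walk adj p \<Longrightarrow> homotopic adj p p"
| hom_cancel: "is_walk adj (p @ [a, b, a] @ q) \<Longrightarrow> is_walk adj (p @ [a] @ q) \<Longrightarrow>
     homotopic adj (p @ [a, b, a] @ q) (p @ [a] @ q)"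
| hom_sym: "homotopic adj p q \<Longrightarrow> homotopic adj q p"
| hom_trans: "homotopic adj p q \<Longrightarrow> homotopic adj q r \<Longrightarrow> homotopic adj p r"

type_synonym 'v arrow = "'v list set"

definition walk_class :: "('v \<Rightarrow> 'v \<Rightarrow> bool) \<Rightarrow> 'v list \<Rightarrow> 'v arrow" where
  "walk_class adj p = {q. homotopic adj p q}"

definition arrows :: "('v \<Rightarrow> 'v \<Rightarrow> bool) \<Rightarrow> 'v arrow set" where
  "arrows adj = walk_class adj ` {p. is_walk adj p}"

definition src :: "'v arrow \<Rightarrow> 'v" where
  "src \<alpha> = hd (SOME p. p \<in> \<alpha>)"

definition tgt :: "'v arrow \<Rightarrow> 'v" where
  "tgt \<alpha> = last (SOME p. p \<in> \<alpha>)"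

text \<open>The composite of \<open>\<alpha>\<close> followed by \<open>\<beta>\<close>, meaningful if \<open>tgt \<alpha> = src \<beta>\<close>.\<close>

definition arrow_comp :: "('v \<Rightarrow> 'v \<Rightarrow> bool) \<Rightarrow> 'v arrow \<Rightarrow> 'v arrow \<Rightarrow> 'v arrow" where
  "arrow_comp adj \<beta> \<alpha> = (\<Union>p\<in>\<alpha>. \<Union>q\<in>\<beta>. walk_class adj (p @ tl q))"

definition edge_arrow :: "('v \<Rightarrow> 'v \<Rightarrow> bool) \<Rightarrow> 'v \<Rightarrow> 'v \<Rightarrow> 'v arrow" where
  "edge_arrow adj d a = walk_class adj [d, a]"

lemma homotopic_is_walk: "homotopic adj p q \<Longrightarrow> is_walk adj p \<and> is_walk adj q"
  by (induction rule: homotopic.induct) auto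

lemma homotopic_ends: "homotopic adj p q \<Longrightarrow> hd p = hd q \<and> last p = last q"
proof (induction rule: homotopic.induct)
  case (hom_cancel p a b q)
  then show ?case by (cases p; cases q rule: rev_cases) auto
qed auto

lemma src_tgt_walk_class:
  assumes "is_walk adj p"
  shows "src (walk_class adj p) = hd p" "tgt (walk_class adj p) = last p"
proof -
  have "(SOME q. q \<in> walk_class adj p) \<in> walk_class adj p"
    by (rule someI[of _ p]) (simp add: walk_class_def homotopic.hom_refl assms)
  then have "homotopic adj p (SOME q. q \<in> walk_class adj p)"
    by (simp add: walk_class_def)
  then show "src (walk_class adj p) = hd p" "tgt (walk_class adj p) = last p"
    using homotopic_ends[of adj p "SOME q. q \<in> walk_class adj p"] by (auto simp: src_def tgt_def)
qed

lemma walk_class_eqI: "homotopic adj p q \<Longrightarrow> walk_class adj p = walk_class adj q"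
  unfolding walk_class_def by (blast intro: homotopic.hom_sym homotopic.hom_trans)

lemma is_walk_append:
  assumes "is_walk adj p" "is_walk adj q" "last p = hd q"
  shows "is_walk adj (p @ tl q)"
  using assms by (cases q; cases "tl q") (auto simp: is_walk_def successively_append_iff)

lemma homotopic_append_right:
  assumes "homotopic adj p p'" "is_walk adj q" "last p = hd q"
  shows "homotopic adj (p @ tl q) (p' @ tl q)"
  using assms
proof (induction rule: homotopic.induct)
  case (hom_refl p)
  then show ?case by (simp add: homotopic.hom_refl is_walk_append)
next
  case (hom_cancel p a b r)
  have "is_walk adj ((p @ [a, b, a] @ r) @ tl q)"
    using hom_cancel by (intro is_walk_append) auto
  moreover have "is_walk adj ((p @ [a] @ r) @ tl q)"
    using hom_cancel by (intro is_walk_append) (auto split: if_splits)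
  ultimately show ?case
    using homotopic.hom_cancel[of adj p a b "r @ tl q"] by simp
next
  case (hom_sym p p')
  then show ?case using homotopic_ends[OF hom_sym.hyps] by (auto intro: homotopic.hom_sym)
next
  case (hom_trans p p' p'')
  then show ?case using homotopic_ends[OF hom_trans.hyps(1)] by (auto intro: homotopic.hom_trans)
qed

lemma homotopic_append_left:
  assumes "homotopic adj q q'" "is_walk adj p" "last p = hd q"
  shows "homotopic adj (p @ tl q) (p @ tl q')"
  using assms
proof (induction rule: homotopic.induct)
  case (hom_refl p)
  then show ?case by (simp add: homotopic.hom_refl is_walk_append)
next
  case (hom_cancel r a b s)
  have ends: "last p = hd (r @ [a] @ s)" "hd (r @ [a, b, a] @ s) = hd (r @ [a] @ s)"
    using hom_cancel by (cases r; simp)+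
  have pos: "is_walk adj (p @ tl (r @ [a, b, a] @ s))" "is_walk adj (p @ tl (r @ [a] @ s))"
    using hom_cancel(1,2,3) ends by (metis is_walk_append)+
  show ?case
  proof (cases r)
    case Nil
    then have "p = butlast p @ [a]"
      using hom_cancel by (metis append_Cons append_Nil append_butlast_last_id is_walk_def list.sel(1))
    then have *: "p @ t = butlast p @ [a] @ t" for t
      by (metis append.assoc)
    show ?thesis
      using homotopic.hom_cancel[of adj "butlast p" a b s] pos unfolding Nil by (simp add: *)
  next
    case (Cons c r')
    then show ?thesis using homotopic.hom_cancel[of adj "p @ r'" a b s] pos by simp
  qed
next
  case (hom_sym q q')
  then show ?case using homotopic_ends[OF hom_sym.hyps] by (auto intro: homotopic.hom_sym)
next
  case (hom_trans q q' q'')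
  then show ?case using homotopic_ends[OF hom_trans.hyps(1)] by (auto intro: homotopic.hom_trans)
qed

lemma arrow_comp_walk_class:
  assumes "is_walk adj p" "is_walk adj q" "last p = hd q"
  shows "arrow_comp adj (walk_class adj q) (walk_class adj p) = walk_class adj (p @ tl q)"
proof -
  have eq: "walk_class adj (p' @ tl q') = walk_class adj (p @ tl q)"
    if "p' \<in> walk_class adj p" "q' \<in> walk_class adj q" for p' q'
  proof -
    have hom: "homotopic adj p p'" "homotopic adj q q'"
      using that by (simp_all add: walk_class_def)
    have q': "is_walk adj q'" "last p = hd q'"
      using homotopic_is_walk[OF hom(2)] homotopic_ends[OF hom(2)] assms by simp_all
    show ?thesis
      using walk_class_eqI[OF homotopic_append_left[OF hom(2) assms(1,3)]]
        walk_class_eqI[OF homotopic_append_right[OF hom(1) q']] by simp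
  qed
  have "p \<in> walk_class adj p" "q \<in> walk_class adj q"
    using assms by (simp_all add: walk_class_def homotopic.hom_refl)
  moreover have "arrow_comp adj (walk_class adj q) (walk_class adj p) =
      (\<Union>p'\<in>walk_class adj p. \<Union>q'\<in>walk_class adj q. walk_class adj (p @ tl q))"
    unfolding arrow_comp_def by (intro SUP_cong HOL.refl eq)
  ultimately show ?thesis by blast
qed

lemma edge_arrow_inverse:
  assumes "adj d a" "adj a d"
  shows "arrow_comp adj (edge_arrow adj a d) (edge_arrow adj d a) = walk_class adj [d]"
proof -
  have "arrow_comp adj (edge_arrow adj a d) (edge_arrow adj d a) = walk_class adj [d, a, d]"
    using assms arrow_comp_walk_class[of adj "[d, a]" "[a, d]"]
    by (simp add: edge_arrow_def is_walk_def)
  moreover have "homotopic adj [d, a, d] [d]"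
    using assms homotopic.hom_cancel[of adj "[]" d a "[]"] by (simp add: is_walk_def)
  ultimately show ?thesis
    by (simp add: walk_class_eqI)
qed


section \<open>Graded vector spaces\<close>

text \<open>
  Graded vector spaces are families of subspaces, indexed by arrows, of a coordinate space
  \<open>complex ^ 'b\<close>. The tensor product of vectors is formed in coordinates, with the index type of the
  second and third factors of a triple product paired first.
\<close>

type_synonym ('v, 'b) graded = "'v arrow \<Rightarrow> (complex ^ 'b) set"

definition tensor :: "complex ^ 'b::finite \<Rightarrow> complex ^ 'c::finite \<Rightarrow> complex ^ ('b \<times> 'c)"
    (infixr "\<otimes>\<^sub>v" 75) where
  "u \<otimes>\<^sub>v w = (\<chi> p. u $ fst p * w $ snd p)"

definition tensor_assoc ::
    "complex ^ (('b::finite \<times> 'c::finite) \<times> 'd::finite) \<Rightarrow> complex ^ ('b \<times> 'c \<times> 'd)" where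
  "tensor_assoc \<psi> = (\<chi> p. \<psi> $ ((fst p, fst (snd p)), snd (snd p)))"

definition graded_tensor :: "('v \<Rightarrow> 'v \<Rightarrow> bool) \<Rightarrow> ('v, 'b::finite) graded \<Rightarrow> ('v, 'c::finite) graded
    \<Rightarrow> ('v, 'b \<times> 'c) graded" where
  "graded_tensor adj V W \<gamma> = vec.span {u \<otimes>\<^sub>v w | u w \<alpha> \<beta>.
     \<alpha> \<in> arrows adj \<and> \<beta> \<in> arrows adj \<and> tgt \<alpha> = src \<beta> \<and> arrow_comp adj \<beta> \<alpha> = \<gamma> \<and>
     u \<in> V \<alpha> \<and> w \<in> W \<beta>}"

definition source_fiber ::
    "('v \<Rightarrow> 'v \<Rightarrow> bool) \<Rightarrow> ('v, 'b::finite) graded \<Rightarrow> 'v \<Rightarrow> (complex ^ 'b) set" where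
  "source_fiber adj W a = vec.span (\<Union>\<alpha> \<in> {\<alpha> \<in> arrows adj. src \<alpha> = a}. W \<alpha>)"

definition edge_vec :: "'v \<times> 'v \<Rightarrow> complex ^ ('v::finite \<times> 'v)" where
  "edge_vec b = axis b 1"

definition edge_space :: "('v::finite \<Rightarrow> 'v \<Rightarrow> bool) \<Rightarrow> ('v, 'v \<times> 'v) graded" where
  "edge_space adj \<alpha> = vec.span {edge_vec (d, a) | d a. adj d a \<and> edge_arrow adj d a = \<alpha>}"


section \<open>The dynamical operators\<close>

text \<open>
  An operator on a source fiber is given as a map on the whole coordinate space, of which only the
  restriction to the fiber is relevant.  The maps below are the linear extensions of their values on
  the tensor products of the basis vectors.
\<close>

definition T_op :: "('v::finite \<Rightarrow> 'v \<Rightarrow> bool) \<Rightarrow> real ^ 'v \<Rightarrow> 'v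
    \<Rightarrow> complex ^ (('v \<times> 'v) \<times> ('v \<times> 'v)) \<Rightarrow> complex ^ (('v \<times> 'v) \<times> ('v \<times> 'v))" where
  "T_op adj S d \<phi> = (\<Sum>a | adj d a. \<phi> $ ((d, a), (a, d)) *s
     (\<Sum>c | adj d c. complex_of_real (sqrt ((S $ a * S $ c) / (S $ d * S $ d))) *s
        (edge_vec (d, c) \<otimes>\<^sub>v edge_vec (c, d))))"

definition lift12 :: "('v::finite \<Rightarrow> complex ^ (('v \<times> 'v) \<times> ('v \<times> 'v)) \<Rightarrow> complex ^ (('v \<times> 'v) \<times> ('v \<times> 'v)))
    \<Rightarrow> 'v \<Rightarrow> complex ^ (('v \<times> 'v) \<times> ('v \<times> 'v) \<times> ('v \<times> 'v))
    \<Rightarrow> complex ^ (('v \<times> 'v) \<times> ('v \<times> 'v) \<times> ('v \<times> 'v))" where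
  "lift12 X a \<psi> = (\<Sum>b\<^sub>1\<in>UNIV. \<Sum>b\<^sub>2\<in>UNIV. \<Sum>b\<^sub>3\<in>UNIV.
     \<psi> $ (b\<^sub>1, b\<^sub>2, b\<^sub>3) *s tensor_assoc (X a (edge_vec b\<^sub>1 \<otimes>\<^sub>v edge_vec b\<^sub>2) \<otimes>\<^sub>v edge_vec b\<^sub>3))"

text \<open>
  The dynamical parameter of the second operator is the target of the first arrow, that is
  \<open>snd b\<^sub>1\<close> for the arrow from \<open>fst b\<^sub>1\<close> to \<open>snd b\<^sub>1\<close>. The base vertex
  of the lifted operator only selects the source fiber, so it is not an argument.
\<close>

definition lift23 :: "('v::finite \<Rightarrow> complex ^ (('v \<times> 'v) \<times> ('v \<times> 'v)) \<Rightarrow> complex ^ (('v \<times> 'v) \<times> ('v \<times> 'v)))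
    \<Rightarrow> complex ^ (('v \<times> 'v) \<times> ('v \<times> 'v) \<times> ('v \<times> 'v))
    \<Rightarrow> complex ^ (('v \<times> 'v) \<times> ('v \<times> 'v) \<times> ('v \<times> 'v))" where
  "lift23 X \<psi> = (\<Sum>b\<^sub>1\<in>UNIV. \<Sum>b\<^sub>2\<in>UNIV. \<Sum>b\<^sub>3\<in>UNIV.
     \<psi> $ (b\<^sub>1, b\<^sub>2, b\<^sub>3) *s (edge_vec b\<^sub>1 \<otimes>\<^sub>v X (snd b\<^sub>1) (edge_vec b\<^sub>2 \<otimes>\<^sub>v edge_vec b\<^sub>3)))"

definition spectral_parametrization :: "complex \<Rightarrow> complex" where
  "spectral_parametrization z = z / (1 - z)"

definition R_check :: "('v::finite \<Rightarrow> 'v \<Rightarrow> bool) \<Rightarrow> real ^ 'v \<Rightarrow> complex \<Rightarrow> 'v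
    \<Rightarrow> complex ^ (('v \<times> 'v) \<times> ('v \<times> 'v)) \<Rightarrow> complex ^ (('v \<times> 'v) \<times> ('v \<times> 'v))" where
  "R_check adj S z a \<phi> = \<phi> + (z / (1 - z)) *s T_op adj S a \<phi>"

lemma tensor_nth [simp]: "(u \<otimes>\<^sub>v w) $ p = u $ fst p * w $ snd p"
  by (simp add: tensor_def)

lemma tensor_assoc_nth [simp]: "tensor_assoc \<psi> $ (i, j, k) = \<psi> $ ((i, j), k)"
  by (simp add: tensor_assoc_def)

lemma edge_vec_nth: "edge_vec b $ c = of_bool (b = c)"
  by (auto simp: edge_vec_def axis_def)

lemma T_op_basis:
  assumes "adj d a"
  shows "T_op adj S d (edge_vec (d, a) \<otimes>\<^sub>v edge_vec (a, d)) =
    (\<Sum>c | adj d c. complex_of_real (sqrt ((S $ a * S $ c) / (S $ d * S $ d))) *s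
        (edge_vec (d, c) \<otimes>\<^sub>v edge_vec (c, d)))"
    and "b \<noteq> d \<Longrightarrow> T_op adj S d (edge_vec (d, a) \<otimes>\<^sub>v edge_vec (a, b)) = 0"
proof -
  have "(\<Sum>x | adj d x. (edge_vec (d, a) \<otimes>\<^sub>v edge_vec (a, d)) $ ((d, x), (x, d)) *s F x) = F a" for F :: "_ \<Rightarrow> complex ^ _"
  proof -
    have "(\<Sum>x | adj d x. (edge_vec (d, a) \<otimes>\<^sub>v edge_vec (a, d)) $ ((d, x), (x, d)) *s F x) =
      (\<Sum>x | adj d x. if x = a then F x else 0)"
      by (intro sum.cong) (auto simp: edge_vec_nth)
    then show ?thesis using assms by (simp add: sum.delta)
  qed
  then show "T_op adj S d (edge_vec (d, a) \<otimes>\<^sub>v edge_vec (a, d)) =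
    (\<Sum>c | adj d c. complex_of_real (sqrt ((S $ a * S $ c) / (S $ d * S $ d))) *s
        (edge_vec (d, c) \<otimes>\<^sub>v edge_vec (c, d)))"
    by (simp only: T_op_def)
  show "b \<noteq> d \<Longrightarrow> T_op adj S d (edge_vec (d, a) \<otimes>\<^sub>v edge_vec (a, b)) = 0"
    by (auto simp: T_op_def edge_vec_nth intro!: sum.neutral)
qed

lemma linear_tensor_expand:
  fixes u v :: "complex ^ ('v::finite \<times> 'v)"
  assumes "Vector_Spaces.linear (*s) (*s) (F :: complex ^ (('v \<times> 'v) \<times> ('v \<times> 'v)) \<Rightarrow> complex ^ 'n)"
  shows "F (u \<otimes>\<^sub>v v) = (\<Sum>i\<in>UNIV. \<Sum>j\<in>UNIV. (u $ i * v $ j) *s F (edge_vec i \<otimes>\<^sub>v edge_vec j))"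
proof -
  have ax: "edge_vec i \<otimes>\<^sub>v edge_vec j = axis (i, j) 1" for i j :: "'v \<times> 'v"
    by (auto simp: vec_eq_iff edge_vec_def axis_def)
  have "u \<otimes>\<^sub>v v = (\<Sum>p\<in>UNIV. (u $ fst p * v $ snd p) *s axis p 1)"
    using basis_expansion[of "u \<otimes>\<^sub>v v"] by simp
  also have "\<dots> = (\<Sum>i\<in>UNIV. \<Sum>j\<in>UNIV. (u $ i * v $ j) *s (edge_vec i \<otimes>\<^sub>v edge_vec j))"
    unfolding ax by (simp add: sum.cartesian_product case_prod_unfold UNIV_Times_UNIV)
  finally show ?thesis
    by (simp add: vec.linear_scale[OF assms] vec.linear_sum[OF assms])
qed

lemma lift12_tensor:
  fixes u v w :: "complex ^ ('v::finite \<times> 'v)"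
  assumes "Vector_Spaces.linear (*s) (*s) (X a)"
  shows "lift12 X a (u \<otimes>\<^sub>v v \<otimes>\<^sub>v w) = tensor_assoc (X a (u \<otimes>\<^sub>v v) \<otimes>\<^sub>v w)"
proof -
  have "lift12 X a (u \<otimes>\<^sub>v v \<otimes>\<^sub>v w) $ (i, j, k) = X a (u \<otimes>\<^sub>v v) $ (i, j) * w $ k" for i j k
  proof -
    have "lift12 X a (u \<otimes>\<^sub>v v \<otimes>\<^sub>v w) $ (i, j, k) =
      (\<Sum>b\<^sub>1\<in>UNIV. \<Sum>b\<^sub>2\<in>UNIV. \<Sum>b\<^sub>3\<in>UNIV. if b\<^sub>3 = k then
        u $ b\<^sub>1 * v $ b\<^sub>2 * X a (edge_vec b\<^sub>1 \<otimes>\<^sub>v edge_vec b\<^sub>2) $ (i, j) * w $ k else 0)"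
      unfolding lift12_def sum_component by (intro sum.cong refl) (simp add: edge_vec_nth)
    also have "\<dots> = X a (u \<otimes>\<^sub>v v) $ (i, j) * w $ k"
      unfolding linear_tensor_expand[OF assms, of u v] by (simp add: sum_distrib_right)
    finally show ?thesis .
  qed
  then show ?thesis by (auto simp: vec_eq_iff)
qed

lemma edge_space_nth:
  assumes "u \<in> edge_space adj \<alpha>" "u $ b \<noteq> 0"
  shows "adj (fst b) (snd b) \<and> edge_arrow adj (fst b) (snd b) = \<alpha>"
proof (rule ccontr)
  assume b: "\<not> ?thesis"
  have "u $ b = 0"
    using assms(1) unfolding edge_space_def
  proof (induction rule: vec.span_induct_alt)
    case (step c x y)
    then show ?case using b by (auto simp: edge_vec_nth)
  qed simp
  with assms(2) show False by simp
qed

lemma lift23_tensor: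
  fixes u v w :: "complex ^ ('v::finite \<times> 'v)"
  assumes lin: "\<And>a. Vector_Spaces.linear (*s) (*s) (X a)" and u: "u \<in> edge_space adj \<alpha>"
  shows "lift23 X (u \<otimes>\<^sub>v v \<otimes>\<^sub>v w) = u \<otimes>\<^sub>v X (tgt \<alpha>) (v \<otimes>\<^sub>v w)"
proof -
  have "lift23 X (u \<otimes>\<^sub>v v \<otimes>\<^sub>v w) $ (i, j) = u $ i * X (tgt \<alpha>) (v \<otimes>\<^sub>v w) $ j" for i j
  proof -
    have "lift23 X (u \<otimes>\<^sub>v v \<otimes>\<^sub>v w) $ (i, j) =
      (\<Sum>b\<in>UNIV. if b = i then u $ i * X (snd i) (v \<otimes>\<^sub>v w) $ j else 0)"
      unfolding lift23_def sum_component
    proof (intro sum.cong refl)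
      fix b
      show "(\<Sum>b\<^sub>2\<in>UNIV. \<Sum>b\<^sub>3\<in>UNIV. ((u \<otimes>\<^sub>v v \<otimes>\<^sub>v w) $ (b, b\<^sub>2, b\<^sub>3) *s
          (edge_vec b \<otimes>\<^sub>v X (snd b) (edge_vec b\<^sub>2 \<otimes>\<^sub>v edge_vec b\<^sub>3))) $ (i, j)) =
        (if b = i then u $ i * X (snd i) (v \<otimes>\<^sub>v w) $ j else 0)"
        unfolding linear_tensor_expand[OF lin, of _ v w]
        by (simp add: edge_vec_nth sum_distrib_left mult.assoc)
    qed
    also have "\<dots> = u $ i * X (snd i) (v \<otimes>\<^sub>v w) $ j" by simp
    also have "\<dots> = u $ i * X (tgt \<alpha>) (v \<otimes>\<^sub>v w) $ j"
    proof (cases "u $ i = 0")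
      case False
      then have "tgt \<alpha> = snd i"
        using edge_space_nth[OF u False] src_tgt_walk_class[of adj "[fst i, snd i]"]
        by (auto simp: edge_arrow_def is_walk_def)
      then show ?thesis by simp
    qed simp
    finally show ?thesis .
  qed
  then show ?thesis by (auto simp: vec_eq_iff)
qed

end

theory Submission
  imports Defs
begin

text \<open>
  For each affine graph the Dynkin marks form a positive eigenvector of the adjacency matrix with
  eigenvalue 2, and a positive eigenvector of a nonnegative matrix always belongs to the eigenvalue
  of largest modulus. Hence the Perron--Frobenius eigenvalue is 2, and the addition rule for
  \<open>z / (1 - z)\<close> becomes a computation with fractions.

  The Yang--Baxter equation rests on the fact that \<open>T_op adj S d\<close> has rank one: it pairs a vector with a
  covector \<open>cap\<close> and multiplies a vector \<open>cup\<close> by the result, both having the coefficients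
  \<open>sqrt (S $ c / S $ d)\<close> on the backtracking walks from \<open>d\<close> over \<open>c\<close> to \<open>d\<close>. The eigenvalue equation says that
  the cap of the cup is 2. The coefficients for \<open>(d, c)\<close> and \<open>(c, d)\<close> are inverse to each other, so that a
  cup in the first two factors followed by a cap in the last two is the identity. Consequently
  the operators \<open>P\<close> and \<open>Q\<close> that act by \<open>T_op\<close> in the first two and in the last two factors satisfy the Temperley--Lieb
  relations \<open>P\<^sup>2 = 2P\<close>, \<open>Q\<^sup>2 = 2Q\<close>, \<open>PQP = P\<close>, \<open>QPQ = Q\<close>
  (\<open>lift12_T_op_square\<close>, \<open>lift23_T_op_square\<close>, \<open>lift12_lift23_lift12\<close>, \<open>lift23_lift12_lift23\<close>),
  the last two on vectors supported on walks that start at the given vertex.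
  For such a pair the Yang--Baxter equation of \<open>1 + xP\<close> and \<open>1 + xQ\<close> comes
  down to one scalar condition on the parameters (\<open>yang_baxter_of_temperley_lieb\<close>), and this is the
  addition rule.
\<close>

section \<open>The Perron--Frobenius eigenvalue\<close>

text \<open>
  Measure the entries of a complex eigenvector \<open>v\<close> for \<open>k\<close> in units of \<open>S\<close>, and let \<open>m\<close> be the largest
  quotient \<open>cmod (v $ i) / S $ i\<close>. At an index \<open>i\<close> where it is attained, the triangle inequality gives
  \<open>cmod k * (m * S $ i) \<le> \<rho> * (m * S $ i)\<close>.
\<close>

lemma perron_frobenius_eigenvalue_eqI:
  fixes A :: "real ^ 'n::finite ^ 'n" and S :: "real ^ 'n"
  assumes nonneg: "\<And>i j. A $ i $ j \<ge> 0" and pos: "\<And>i. S $ i > 0" and eig: "A *v S = \<rho> *s S"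
  shows "perron_frobenius_eigenvalue A = \<rho>"
proof -
  have row: "(\<Sum>j\<in>UNIV. A $ i $ j * S $ j) = \<rho> * S $ i" for i
    using eig by (auto simp: vec_eq_iff matrix_vector_mult_def)
  show ?thesis
    unfolding perron_frobenius_eigenvalue_def
  proof (rule Greatest_equality)
    have "\<rho> * S $ i \<ge> 0" for i
      unfolding row[symmetric] using nonneg pos by (intro sum_nonneg) (simp add: less_imp_le)
    then have \<rho>: "\<rho> \<ge> 0"
      using pos by (metis mult_neg_pos not_less)
    let ?v = "\<chi> i. complex_of_real (S $ i)"
    have "map_matrix complex_of_real A *v ?v = complex_of_real \<rho> *s ?v"
      by (simp add: vec_eq_iff matrix_vector_mult_def map_matrix_def flip: of_real_mult of_real_sum row)
    moreover have "?v \<noteq> 0"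
      using pos by (auto simp: vec_eq_iff) (metis less_irrefl)
    ultimately show "\<exists>k v. v \<noteq> 0 \<and> map_matrix complex_of_real A *v v = k *s v \<and> \<rho> = cmod k"
      using \<rho> by (intro exI[of _ "complex_of_real \<rho>"] exI[of _ ?v]) auto
  next
    fix r
    assume "\<exists>k v. v \<noteq> 0 \<and> map_matrix complex_of_real A *v v = k *s v \<and> r = cmod k"
    then obtain k v where v: "v \<noteq> 0" "map_matrix complex_of_real A *v v = k *s v" "r = cmod k"
      by blast
    define q where "q i = cmod (v $ i) / S $ i" for i
    define m where "m = Max (range q)"
    have q_le: "q i \<le> m" for i
      unfolding m_def by (intro Max_ge) auto
    have "m \<in> range q"
      unfolding m_def by (intro Max_in) auto
    then obtain i where i: "q i = m" by auto
    have v_le: "cmod (v $ j) \<le> m * S $ j" for j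
      using q_le[of j] pos[of j] by (simp add: q_def field_simps)
    have vi: "cmod (v $ i) = m * S $ i"
      using i pos[of i] by (auto simp: q_def field_simps)
    obtain j where "v $ j \<noteq> 0"
      using v(1) by (auto simp: vec_eq_iff)
    then have "m * S $ j > 0"
      using v_le[of j] by (meson less_le_trans zero_less_norm_iff)
    then have "m > 0"
      using pos[of j] by (simp add: zero_less_mult_iff)
    have "r * (m * S $ i) = cmod (\<Sum>j\<in>UNIV. complex_of_real (A $ i $ j) * v $ j)"
      using v(2) unfolding v(3) vi[symmetric]
      by (simp add: vec_eq_iff matrix_vector_mult_def map_matrix_def norm_mult)
    also have "\<dots> \<le> (\<Sum>j\<in>UNIV. A $ i $ j * (m * S $ j))"
      using nonneg v_le by (intro sum_norm_le) (auto simp: norm_mult intro: mult_left_mono)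
    also have "\<dots> = \<rho> * (m * S $ i)"
      using row[of i] by (simp add: sum_distrib_left[symmetric] mult.left_commute)
    finally show "r \<le> \<rho>"
      using \<open>m > 0\<close> pos[of i] by simp
  qed
qed

text \<open>
  With this form of the left side, sums over the neighbours of a vertex of an explicitly given graph are computed by
  simplification.
\<close>

lemma sum_below_filter:
  fixes g :: "nat \<Rightarrow> 'a::comm_monoid_add"
  shows "(\<Sum>j | j < N \<and> P j. g j) = sum_list (map g (filter P [0..<N]))"
  by (subst sum_list_distinct_conv_sum_set) (auto intro: sum.cong)

text \<open>
  The witnesses are the marks of the affine Dynkin diagrams, that is, the coefficients of the
  minimal positive imaginary root.
\<close>

lemma affine_ADE_model_marks:
  assumes "affine_ADE_model N E"
  shows "\<exists>g :: nat \<Rightarrow> real. (\<forall>i<N. g i > 0) \<and>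
    (\<forall>i<N. (\<Sum>j | j < N \<and> ((i, j) \<in> E \<or> (j, i) \<in> E). g j) = 2 * g i)"
  using assms
proof cases
  case (type_A n)
  have "(\<Sum>j | j < N \<and> ((i, j) \<in> E \<or> (j, i) \<in> E). 1 :: real) = 2" if i: "i < N" for i
  proof -
    consider "i = 0" | "i = n" | "0 < i" "i < n" using i type_A by linarith
    then obtain j k where "j \<noteq> k" "{j. j < N \<and> ((i, j) \<in> E \<or> (j, i) \<in> E)} = {j, k}"
    proof cases
      case 1
      then have "{j. j < N \<and> ((i, j) \<in> E \<or> (j, i) \<in> E)} = {1, n}"
        using type_A by auto
      then show ?thesis using 1 type_A by (intro that[of 1 n]) auto
    next
      case 2
      then have "{j. j < N \<and> ((i, j) \<in> E \<or> (j, i) \<in> E)} = {n - 1, 0}"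
        using type_A by auto
      then show ?thesis using 2 type_A by (intro that[of "n - 1" 0]) auto
    next
      case 3
      then have "{j. j < N \<and> ((i, j) \<in> E \<or> (j, i) \<in> E)} = {i - 1, i + 1}"
        using type_A by auto
      then show ?thesis using 3 type_A by (intro that[of "i - 1" "i + 1"]) auto
    qed
    then show ?thesis by simp
  qed
  then show ?thesis by (intro exI[of _ "\<lambda>_. 1"]) simp
next
  case (type_D n)
  then obtain m where n: "n = m + 4"
    using le_Suc_ex[of 4 n] by (auto simp: add.commute)
  have E: "(i, j) \<in> E \<longleftrightarrow> i = 0 \<and> j = 2 \<or> (1 \<le> i \<and> i \<le> m + 2 \<and> j = i + 1) \<or> i = m + 2 \<and> j = m + 4" for i j
    by (auto simp: type_D(2) n)
  have N: "N = m + 5"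
    by (simp add: type_D(1) n)
  define g :: "nat \<Rightarrow> real" where "g i = (if i = 0 \<or> i = 1 \<or> i = m + 3 \<or> i = m + 4 then 1 else 2)" for i
  have "(\<Sum>j | j < N \<and> ((i, j) \<in> E \<or> (j, i) \<in> E). g j) = 2 * g i" if "i < N" for i
  proof -
    let ?nb = "{j. j < N \<and> ((i, j) \<in> E \<or> (j, i) \<in> E)}"
    \<comment> \<open>The branch vertices \<open>2\<close> and \<open>m + 2\<close> coincide for \<open>m = 0\<close>.\<close>
    consider "i = 0" | "i = 1" | "i = m + 3" | "i = m + 4"
      | "i = 2" "m = 0" | "i = 2" "m > 0" | "i = m + 2" "m > 0" | "2 < i" "i < m + 2"
      using \<open>i < N\<close> unfolding N by linarith
    then show ?thesis
    proof cases
      case 1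
      then have "?nb = {2}"
        unfolding set_eq_iff mem_Collect_eq insert_iff empty_iff E N by presburger
      moreover have "sum g {2} = 2 * g i"
        using 1 by (simp add: g_def)
      ultimately show ?thesis by simp
    next
      case 2
      then have "?nb = {2}"
        unfolding set_eq_iff mem_Collect_eq insert_iff empty_iff E N by presburger
      moreover have "sum g {2} = 2 * g i"
        using 2 by (simp add: g_def)
      ultimately show ?thesis by simp
    next
      case 3
      then have "?nb = {m + 2}"
        unfolding set_eq_iff mem_Collect_eq insert_iff empty_iff E N by presburger
      moreover have "sum g {m + 2} = 2 * g i"
        using 3 by (simp add: g_def)
      ultimately show ?thesis by simp
    next
      case 4
      then have "?nb = {m + 2}"
        unfolding set_eq_iff mem_Collect_eq insert_iff empty_iff E N by presburger
      moreover have "sum g {m + 2} = 2 * g i"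
        using 4 by (simp add: g_def)
      ultimately show ?thesis by simp
    next
      case 5
      then have "?nb = {0, 1, 3, 4}"
        unfolding set_eq_iff mem_Collect_eq insert_iff empty_iff E N by presburger
      moreover have "sum g {0, 1, 3, 4} = 2 * g i"
        using 5 by (simp add: g_def)
      ultimately show ?thesis by simp
    next
      case 6
      then have "?nb = {0, 1, 3}"
        unfolding set_eq_iff mem_Collect_eq insert_iff empty_iff E N by presburger
      moreover have "sum g {0, 1, 3} = 2 * g i"
        using 6 by (simp add: g_def)
      ultimately show ?thesis by simp
    next
      case 7
      then have "?nb = {m + 1, m + 3, m + 4}"
        unfolding set_eq_iff mem_Collect_eq insert_iff empty_iff E N by presburger
      moreover have "sum g {m + 1, m + 3, m + 4} = 2 * g i"
        using 7 by (simp add: g_def)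
      ultimately show ?thesis by simp
    next
      case 8
      then have "?nb = {i - 1, i + 1}"
        unfolding set_eq_iff mem_Collect_eq insert_iff empty_iff E N by presburger
      moreover have "sum g {i - 1, i + 1} = 2 * g i"
        using 8 by (auto simp: g_def)
      ultimately show ?thesis by simp
    qed
  qed
  moreover have "g i > 0" for i
    by (simp add: g_def)
  ultimately show ?thesis by blast
next
  case type_E6
  let ?g = "\<lambda>i. [1, 2, 3, 2, 1, 2, 1] ! i :: real"
  have "?g i > 0 \<and> (\<Sum>j | j < N \<and> ((i, j) \<in> E \<or> (j, i) \<in> E). ?g j) = 2 * ?g i" if "i < N" for i
  proof -
    have "i = 0 \<or> i = 1 \<or> i = 2 \<or> i = 3 \<or> i = 4 \<or> i = 5 \<or> i = 6"
      using that type_E6 by (simp add: less_Suc_eq numeral_eq_Suc)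
    then show ?thesis
      unfolding sum_below_filter type_E6 by (elim disjE) (simp_all add: upt_rec)
  qed
  then show ?thesis by (intro exI[of _ ?g]) blast
next
  case type_E7
  let ?g = "\<lambda>i. [1, 2, 3, 4, 3, 2, 1, 2] ! i :: real"
  have "?g i > 0 \<and> (\<Sum>j | j < N \<and> ((i, j) \<in> E \<or> (j, i) \<in> E). ?g j) = 2 * ?g i" if "i < N" for i
  proof -
    have "i = 0 \<or> i = 1 \<or> i = 2 \<or> i = 3 \<or> i = 4 \<or> i = 5 \<or> i = 6 \<or> i = 7"
      using that type_E7 by (simp add: less_Suc_eq numeral_eq_Suc)
    then show ?thesis
      unfolding sum_below_filter type_E7 by (elim disjE) (simp_all add: upt_rec)
  qed
  then show ?thesis by (intro exI[of _ ?g]) blast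
next
  case type_E8
  let ?g = "\<lambda>i. [2, 4, 6, 5, 4, 3, 2, 1, 3] ! i :: real"
  have "?g i > 0 \<and> (\<Sum>j | j < N \<and> ((i, j) \<in> E \<or> (j, i) \<in> E). ?g j) = 2 * ?g i" if "i < N" for i
  proof -
    have "i = 0 \<or> i = 1 \<or> i = 2 \<or> i = 3 \<or> i = 4 \<or> i = 5 \<or> i = 6 \<or> i = 7 \<or> i = 8"
      using that type_E8 by (simp add: less_Suc_eq numeral_eq_Suc)
    then show ?thesis
      unfolding sum_below_filter type_E8 by (elim disjE) (simp_all add: upt_rec)
  qed
  then show ?thesis by (intro exI[of _ ?g]) blast
qed

lemma affine_ADE_symmetric: "affine_ADE adj \<Longrightarrow> adj x y \<Longrightarrow> adj y x"
  by (auto simp: affine_ADE_def)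

lemma adjacency_matrix_mult_nth: "(adjacency_matrix adj *v S) $ i = (\<Sum>j | adj i j. S $ j)"
proof -
  have "(\<Sum>j\<in>UNIV. of_bool (adj i j) * S $ j) = (\<Sum>j | adj i j. S $ j)"
    by (rule sum.mono_neutral_cong_right) auto
  then show ?thesis by (simp add: matrix_vector_mult_def adjacency_matrix_def)
qed

lemma affine_ADE_perron_frobenius:
  fixes adj :: "'v::finite \<Rightarrow> 'v \<Rightarrow> bool"
  assumes "affine_ADE adj"
  shows "perron_frobenius_eigenvalue (adjacency_matrix adj) = 2"
proof -
  from assms obtain N E f where E: "affine_ADE_model N E" and f: "bij_betw f UNIV {..<N}"
    and adj: "\<And>x y. adj x y \<longleftrightarrow> (f x, f y) \<in> E \<or> (f y, f x) \<in> E"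
    unfolding affine_ADE_def by blast
  obtain g :: "nat \<Rightarrow> real" where g: "\<And>i. i < N \<Longrightarrow> g i > 0"
    "\<And>i. i < N \<Longrightarrow> (\<Sum>j | j < N \<and> ((i, j) \<in> E \<or> (j, i) \<in> E). g j) = 2 * g i"
    using affine_ADE_model_marks[OF E] by blast
  have fN: "f x < N" for x
    using f by (auto simp: bij_betw_def)
  have "(\<Sum>y | adj x y. g (f y)) = 2 * g (f x)" for x
  proof -
    have "f ` {y. adj x y} = {j. j < N \<and> ((f x, j) \<in> E \<or> (j, f x) \<in> E)}"
      using f fN by (auto simp: adj bij_betw_def)
    moreover have "inj_on f {y. adj x y}"
      using f by (auto simp: bij_betw_def inj_on_def)
    ultimately show ?thesis
      using g(2)[OF fN] by (metis (no_types, lifting) sum.reindex_cong)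
  qed
  then have "adjacency_matrix adj *v (\<chi> x. g (f x)) = 2 *s (\<chi> x. g (f x))"
    by (simp add: vec_eq_iff adjacency_matrix_mult_nth)
  moreover have "adjacency_matrix adj $ x $ y \<ge> 0" for x y
    by (simp add: adjacency_matrix_def)
  ultimately show ?thesis
    using g(1)[OF fN] by (intro perron_frobenius_eigenvalue_eqI[of _ "\<chi> x. g (f x)"]) auto
qed

section \<open>Cups and caps\<close>

definition cup_weight :: "real ^ 'v \<Rightarrow> 'v \<Rightarrow> 'v \<Rightarrow> complex" where
  "cup_weight S d c = complex_of_real (sqrt (S $ c / S $ d))"

definition cup :: "('v::finite \<Rightarrow> 'v \<Rightarrow> bool) \<Rightarrow> real ^ 'v \<Rightarrow> 'v \<Rightarrow> complex ^ (('v \<times> 'v) \<times> ('v \<times> 'v))" where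
  "cup adj S d = (\<Sum>c | adj d c. cup_weight S d c *s (edge_vec (d, c) \<otimes>\<^sub>v edge_vec (c, d)))"

definition cap :: "('v::finite \<Rightarrow> 'v \<Rightarrow> bool) \<Rightarrow> real ^ 'v \<Rightarrow> 'v
    \<Rightarrow> complex ^ (('v \<times> 'v) \<times> ('v \<times> 'v)) \<Rightarrow> complex" where
  "cap adj S d \<phi> = (\<Sum>c | adj d c. cup_weight S d c * \<phi> $ ((d, c), (c, d)))"

lemma cup_nth:
  "cup adj S d $ ((p, q), (r, s)) =
    (if p = d \<and> s = d \<and> q = r \<and> adj d q then cup_weight S d q else 0)"
proof -
  have "cup adj S d $ ((p, q), (r, s)) =
      (\<Sum>c | adj d c. if c = q then (if p = d \<and> s = d \<and> q = r then cup_weight S d q else 0) else 0)"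
    unfolding cup_def sum_component by (intro sum.cong) (auto simp: edge_vec_nth)
  then show ?thesis by (auto simp: sum.delta)
qed

text \<open>
  The coefficient of \<open>T_op\<close> for \<open>(a, c)\<close> is a product of a factor that depends on \<open>a\<close> only and one that
  depends on \<open>c\<close> only.
\<close>

lemma T_op_eq_cup_cap:
  shows "T_op adj S d \<phi> = cap adj S d \<phi> *s cup adj S d"
proof -
  have *: "complex_of_real (sqrt ((S $ a * S $ c) / (S $ d * S $ d))) = cup_weight S d a * cup_weight S d c" for a c
    by (simp add: cup_weight_def real_sqrt_mult real_sqrt_divide flip: of_real_mult)
  have "(\<Sum>c | adj d c. complex_of_real (sqrt ((S $ a * S $ c) / (S $ d * S $ d))) *s
      (edge_vec (d, c) \<otimes>\<^sub>v edge_vec (c, d))) = cup_weight S d a *s cup adj S d" for a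
    unfolding * cup_def vec.scale_sum_right by simp
  then show ?thesis
    by (simp add: T_op_def cap_def vec.scale_sum_left mult.commute)
qed

lemma cup_weight_inverse:
  assumes "\<And>i. S $ i > 0"
  shows "cup_weight S d c * cup_weight S c d = 1"
  using assms[of c] assms[of d] by (simp add: cup_weight_def flip: of_real_mult real_sqrt_mult)

text \<open>
  The squares of the weights are \<open>S $ c / S $ d\<close>, so this is the eigenvalue equation at \<open>d\<close> divided by
  \<open>S $ d\<close>.
\<close>

lemma cap_cup:
  assumes "\<And>i. S $ i > 0" "adjacency_matrix adj *v S = \<kappa> *s S"
  shows "cap adj S d (cup adj S d) = of_real \<kappa>"
proof -
  have "cup_weight S d c * cup_weight S d c = of_real (S $ c / S $ d)" for c
    using assms(1)[of c] assms(1)[of d] by (simp add: cup_weight_def flip: of_real_mult)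
  then have "cap adj S d (cup adj S d) = of_real ((\<Sum>c | adj d c. S $ c) / S $ d)"
    by (simp add: cap_def cup_nth sum_divide_distrib)
  also have "(\<Sum>c | adj d c. S $ c) = \<kappa> * S $ d"
    using assms(2) by (metis adjacency_matrix_mult_nth vector_smult_component)
  finally show ?thesis
    using assms(1)[of d] by simp
qed

lemma cap_add: "cap adj S d (\<phi> + \<phi>') = cap adj S d \<phi> + cap adj S d \<phi>'"
  by (simp add: cap_def algebra_simps sum.distrib)

lemma cap_scale: "cap adj S d (c *s \<phi>) = c * cap adj S d \<phi>"
  by (simp add: cap_def algebra_simps sum_distrib_left)

section \<open>Lifted operators in coordinates\<close>

lemma linear_tensor_basis_expansion:
  fixes \<phi> :: "complex ^ (('v::finite \<times> 'v) \<times> ('v \<times> 'v))"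
  assumes "Vector_Spaces.linear (*s) (*s) (F :: complex ^ (('v \<times> 'v) \<times> ('v \<times> 'v)) \<Rightarrow> complex ^ 'n)"
  shows "(\<Sum>i\<in>UNIV. \<Sum>j\<in>UNIV. \<phi> $ (i, j) *s F (edge_vec i \<otimes>\<^sub>v edge_vec j)) = F \<phi>"
proof -
  have ax: "edge_vec i \<otimes>\<^sub>v edge_vec j = axis (i, j) 1" for i j :: "'v \<times> 'v"
    by (auto simp: vec_eq_iff edge_vec_def axis_def)
  have "F \<phi> = F (\<Sum>p\<in>UNIV. \<phi> $ p *s axis p 1)"
    by (simp add: basis_expansion)
  also have "\<dots> = (\<Sum>p\<in>UNIV. \<phi> $ p *s F (axis p 1))"
    by (simp add: vec.linear_scale[OF assms] vec.linear_sum[OF assms])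
  also have "\<dots> = (\<Sum>i\<in>UNIV. \<Sum>j\<in>UNIV. \<phi> $ (i, j) *s F (edge_vec i \<otimes>\<^sub>v edge_vec j))"
    unfolding ax by (simp add: sum.cartesian_product case_prod_unfold UNIV_Times_UNIV)
  finally show ?thesis ..
qed

text \<open>
  The lifted operators act on the slices of a vector in which the edge of the remaining factor is
  held constant.
\<close>

lemma lift12_nth:
  fixes \<psi> :: "complex ^ (('v::finite \<times> 'v) \<times> ('v \<times> 'v) \<times> ('v \<times> 'v))"
  assumes "Vector_Spaces.linear (*s) (*s) (X a)"
  shows "lift12 X a \<psi> $ (i, j, k) = X a (\<chi> p. \<psi> $ (fst p, snd p, k)) $ (i, j)"
proof -
  have "lift12 X a \<psi> $ (i, j, k) = (\<Sum>b\<in>UNIV. \<Sum>c\<in>UNIV. \<Sum>e\<in>UNIV.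
      if e = k then \<psi> $ (b, c, k) * X a (edge_vec b \<otimes>\<^sub>v edge_vec c) $ (i, j) else 0)"
    unfolding lift12_def sum_component by (intro sum.cong refl) (simp add: edge_vec_nth)
  also have "\<dots> = X a (\<chi> p. \<psi> $ (fst p, snd p, k)) $ (i, j)"
    by (subst linear_tensor_basis_expansion[OF assms, symmetric]) simp
  finally show ?thesis .
qed

lemma lift23_nth:
  fixes \<psi> :: "complex ^ (('v::finite \<times> 'v) \<times> ('v \<times> 'v) \<times> ('v \<times> 'v))"
  assumes "\<And>a. Vector_Spaces.linear (*s) (*s) (X a)"
  shows "lift23 X \<psi> $ (i, p) = X (snd i) (\<chi> q. \<psi> $ (i, q)) $ p"
proof -
  have "lift23 X \<psi> $ (i, p) = (\<Sum>b\<in>UNIV. if b = i then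
      (\<Sum>c\<in>UNIV. \<Sum>e\<in>UNIV. \<psi> $ (i, c, e) * X (snd i) (edge_vec c \<otimes>\<^sub>v edge_vec e) $ p) else 0)"
    unfolding lift23_def sum_component by (intro sum.cong refl) (simp add: edge_vec_nth)
  also have "\<dots> = X (snd i) (\<chi> q. \<psi> $ (i, q)) $ p"
    by (subst linear_tensor_basis_expansion[OF assms, symmetric]) simp
  finally show ?thesis .
qed

lemma linear_T_op:
  shows "Vector_Spaces.linear (*s) (*s) (T_op adj S d)"
  unfolding T_op_eq_cup_cap
  by unfold_locales (simp_all add: cap_add cap_scale vec_eq_iff algebra_simps)

lemma linear_R_check:
  shows "Vector_Spaces.linear (*s) (*s) (R_check adj S z d)"
  unfolding R_check_def T_op_eq_cup_cap
  by unfold_locales (simp_all add: cap_add cap_scale vec_eq_iff algebra_simps)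

lemma linear_lift12: "Vector_Spaces.linear (*s) (*s) (lift12 X a)"
  unfolding lift12_def
  by unfold_locales (simp_all add: vec_eq_iff sum.distrib sum_distrib_left algebra_simps)

lemma linear_lift23: "Vector_Spaces.linear (*s) (*s) (lift23 X)"
  unfolding lift23_def
  by unfold_locales (simp_all add: vec_eq_iff sum.distrib sum_distrib_left algebra_simps)

lemma lift12_T_op_nth:
  shows "lift12 (T_op adj S) a \<psi> $ (i, j, k) =
    cap adj S a (\<chi> p. \<psi> $ (fst p, snd p, k)) * cup adj S a $ (i, j)"
  by (simp add: lift12_nth linear_T_op T_op_eq_cup_cap)

lemma lift23_T_op_nth:
  shows "lift23 (T_op adj S) \<psi> $ (i, p) =
    cap adj S (snd i) (\<chi> q. \<psi> $ (i, q)) * cup adj S (snd i) $ p"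
  by (simp add: lift23_nth linear_T_op T_op_eq_cup_cap)

section \<open>The fiber of three-step walks\<close>

definition walk_supported ::
    "('v::finite \<Rightarrow> 'v \<Rightarrow> bool) \<Rightarrow> 'v \<Rightarrow> complex ^ (('v \<times> 'v) \<times> ('v \<times> 'v) \<times> ('v \<times> 'v)) \<Rightarrow> bool" where
  "walk_supported adj a \<psi> \<longleftrightarrow> (\<forall>p q r s t u. \<psi> $ ((p, q), (r, s), (t, u)) \<noteq> 0 \<longrightarrow>
     p = a \<and> q = r \<and> s = t \<and> adj p q \<and> adj r s \<and> adj t u)"

lemma src_arrow_comp:
  assumes "\<alpha> \<in> arrows adj" "\<beta> \<in> arrows adj" "tgt \<alpha> = src \<beta>"
  shows "src (arrow_comp adj \<beta> \<alpha>) = src \<alpha>"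
proof -
  obtain p q where p: "is_walk adj p" "\<alpha> = walk_class adj p"
    and q: "is_walk adj q" "\<beta> = walk_class adj q"
    using assms by (auto simp: arrows_def)
  then have "last p = hd q"
    using assms(3) by (simp add: src_tgt_walk_class)
  with p q show ?thesis
    by (simp add: arrow_comp_walk_class src_tgt_walk_class is_walk_append) (simp add: is_walk_def)
qed

lemma edge_space_support:
  assumes "u \<in> edge_space adj \<alpha>" "u $ (p, q) \<noteq> 0"
  shows "adj p q" "src \<alpha> = p" "tgt \<alpha> = q"
  using edge_space_nth[OF assms] src_tgt_walk_class[of adj "[p, q]"]
  by (auto simp: edge_arrow_def is_walk_def)

text \<open>
  A coordinate that is nonzero on a linear combination is nonzero on one of the terms, here a tensor
  product of homogeneous vectors. This carries the composability of arrows over to coordinates.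
\<close>

lemma graded_tensor_support:
  assumes "\<phi> \<in> graded_tensor adj V W \<gamma>" "\<phi> $ (i, j) \<noteq> 0"
  obtains u w \<alpha> \<beta> where "\<alpha> \<in> arrows adj" "\<beta> \<in> arrows adj" "tgt \<alpha> = src \<beta>"
    "src \<gamma> = src \<alpha>" "u \<in> V \<alpha>" "w \<in> W \<beta>" "u $ i \<noteq> 0" "w $ j \<noteq> 0"
proof -
  have "\<phi> $ (i, j) \<noteq> 0 \<longrightarrow> (\<exists>u w \<alpha> \<beta>. \<alpha> \<in> arrows adj \<and> \<beta> \<in> arrows adj \<and> tgt \<alpha> = src \<beta> \<and>
      src \<gamma> = src \<alpha> \<and> u \<in> V \<alpha> \<and> w \<in> W \<beta> \<and> u $ i \<noteq> 0 \<and> w $ j \<noteq> 0)"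
    using assms(1) unfolding graded_tensor_def
  proof (induction rule: vec.span_induct_alt)
    case (step c x y)
    then obtain u w \<alpha> \<beta> where x: "x = u \<otimes>\<^sub>v w" and *: "\<alpha> \<in> arrows adj" "\<beta> \<in> arrows adj"
      "tgt \<alpha> = src \<beta>" "arrow_comp adj \<beta> \<alpha> = \<gamma>" "u \<in> V \<alpha>" "w \<in> W \<beta>"
      by blast
    have "src \<gamma> = src \<alpha>"
      using * src_arrow_comp by metis
    show ?case
    proof (cases "u $ i = 0 \<or> w $ j = 0")
      case True
      then show ?thesis using step.IH by (auto simp: x)
    next
      case False
      then show ?thesis using * \<open>src \<gamma> = src \<alpha>\<close> by blast
    qed
  qed simp
  then show thesis using assms(2) that by blast
qed

lemma source_fiber_walk_supported:
  assumes "\<psi> \<in> source_fiber adj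
    (graded_tensor adj (edge_space adj) (graded_tensor adj (edge_space adj) (edge_space adj))) a"
  shows "walk_supported adj a \<psi>"
  using assms unfolding source_fiber_def
proof (induction rule: vec.span_induct_alt)
  case base
  then show ?case by (simp add: walk_supported_def)
next
  case (step c x y)
  then obtain \<gamma> where \<gamma>: "src \<gamma> = a" and
    x: "x \<in> graded_tensor adj (edge_space adj) (graded_tensor adj (edge_space adj) (edge_space adj)) \<gamma>"
    by blast
  have "p = a \<and> q = r \<and> s = t \<and> adj p q \<and> adj r s \<and> adj t u"
    if nz: "x $ ((p, q), (r, s), (t, u)) \<noteq> 0" for p q r s t u
  proof -
    obtain f \<phi> \<alpha> \<beta> where 1: "tgt \<alpha> = src \<beta>" "src \<gamma> = src \<alpha>" "f \<in> edge_space adj \<alpha>"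
      "\<phi> \<in> graded_tensor adj (edge_space adj) (edge_space adj) \<beta>"
      "f $ (p, q) \<noteq> 0" "\<phi> $ ((r, s), (t, u)) \<noteq> 0"
      using graded_tensor_support[OF x nz] by metis
    obtain g h \<alpha>' \<beta>' where 2: "tgt \<alpha>' = src \<beta>'" "src \<beta> = src \<alpha>'" "g \<in> edge_space adj \<alpha>'"
      "h \<in> edge_space adj \<beta>'" "g $ (r, s) \<noteq> 0" "h $ (t, u) \<noteq> 0"
      using graded_tensor_support[OF 1(4,6)] by metis
    show ?thesis
      using edge_space_support[OF 1(3,5)] edge_space_support[OF 2(3,5)] edge_space_support[OF 2(4,6)]
        1(1,2) 2(1,2) \<gamma> by auto
  qed
  then show ?case
    using step.IH unfolding walk_supported_def
    by (metis (no_types, lifting) add_cancel_left_left mult_zero_right vector_add_component vector_smult_component)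
qed

section \<open>Temperley--Lieb relations\<close>

text \<open>
  Every slice of a vector in the image is a multiple of the cup, so that applying the operator again
  only asks for the cap of the cup.
\<close>

lemma lift12_T_op_slice:
  shows "(\<chi> p. lift12 (T_op adj S) a \<psi> $ (fst p, snd p, k)) =
      cap adj S a (\<chi> p. \<psi> $ (fst p, snd p, k)) *s cup adj S a"
  by (simp add: vec_eq_iff lift12_T_op_nth)

lemma lift23_T_op_slice:
  shows "(\<chi> p. lift23 (T_op adj S) \<psi> $ (i, p)) =
      cap adj S (snd i) (\<chi> q. \<psi> $ (i, q)) *s cup adj S (snd i)"
  by (simp add: vec_eq_iff lift23_T_op_nth)

lemma lift12_T_op_square:
  assumes S: "\<And>i. S $ i > 0" "adjacency_matrix adj *v S = \<kappa> *s S"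
  shows "lift12 (T_op adj S) a (lift12 (T_op adj S) a \<psi>) = of_real \<kappa> *s lift12 (T_op adj S) a \<psi>"
proof -
  have "lift12 (T_op adj S) a (lift12 (T_op adj S) a \<psi>) $ (i, j, k) =
      of_real \<kappa> * lift12 (T_op adj S) a \<psi> $ (i, j, k)" for i j k
    unfolding lift12_T_op_nth[where \<psi> = "lift12 (T_op adj S) a \<psi>"] lift12_T_op_slice
    by (simp add: cap_scale cap_cup[OF S] lift12_T_op_nth)
  then show ?thesis
    by (auto simp: vec_eq_iff)
qed

lemma lift23_T_op_square:
  assumes S: "\<And>i. S $ i > 0" "adjacency_matrix adj *v S = \<kappa> *s S"
  shows "lift23 (T_op adj S) (lift23 (T_op adj S) \<psi>) = of_real \<kappa> *s lift23 (T_op adj S) \<psi>"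
proof -
  have "lift23 (T_op adj S) (lift23 (T_op adj S) \<psi>) $ (i, p) =
      of_real \<kappa> * lift23 (T_op adj S) \<psi> $ (i, p)" for i p
    unfolding lift23_T_op_nth[where \<psi> = "lift23 (T_op adj S) \<psi>"] lift23_T_op_slice
    by (simp add: cap_scale cap_cup[OF S] lift23_T_op_nth)
  then show ?thesis
    by (auto simp: vec_eq_iff)
qed

text \<open>
  The zigzag identity. Behind the first edge \<open>(a, b)\<close>, the only middle edge that both the cup at \<open>a\<close> and
  the cap at \<open>b\<close> allow is \<open>(b, a)\<close>, and there their weights are inverse to each other.
\<close>

lemma cap_lift12_T_op:
  assumes S: "\<And>i. S $ i > 0" and sym: "adj b a" "adj a b"
  shows "cap adj S b (\<chi> q. lift12 (T_op adj S) a \<psi> $ ((a, b), q)) =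
    cap adj S a (\<chi> p. \<psi> $ (fst p, snd p, (a, b)))"
proof -
  have "cap adj S b (\<chi> q. lift12 (T_op adj S) a \<psi> $ ((a, b), q)) =
    (\<Sum>e | adj b e. if e = a then cup_weight S a b * cup_weight S b a *
       cap adj S a (\<chi> p. \<psi> $ (fst p, snd p, (a, b))) else 0)"
    unfolding cap_def[of _ _ b] using sym
    by (intro sum.cong) (auto simp: lift12_T_op_nth cup_nth)
  then show ?thesis
    using sym by (simp add: cup_weight_inverse S)
qed

text \<open>
  Both sides are multiples of the cup at \<open>a\<close>, so only the caps need to be compared. By the zigzag
  identity the two agree where the third edge starts at \<open>a\<close>; elsewhere the left one vanishes because
  its cup does, and the right one because a composable walk returning to \<open>a\<close> after two steps must go
  on from \<open>a\<close>.
\<close>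

lemma lift12_lift23_lift12:
  assumes S: "\<And>i. S $ i > 0" and sym: "\<And>x y. adj x y \<Longrightarrow> adj y x"
    and supp: "walk_supported adj a \<psi>"
  shows "lift12 (T_op adj S) a (lift23 (T_op adj S) (lift12 (T_op adj S) a \<psi>)) = lift12 (T_op adj S) a \<psi>"
proof -
  have "cap adj S a (\<chi> p. lift23 (T_op adj S) (lift12 (T_op adj S) a \<psi>) $ (fst p, snd p, k)) =
    cap adj S a (\<chi> p. \<psi> $ (fst p, snd p, k))" for k
  proof (cases k)
    case (Pair k\<^sub>1 k\<^sub>2)
    have "cap adj S a (\<chi> p. lift23 (T_op adj S) (lift12 (T_op adj S) a \<psi>) $ (fst p, snd p, k)) =
      (\<Sum>b | adj a b. cup_weight S a b *
         (cap adj S a (\<chi> p. \<psi> $ (fst p, snd p, (a, b))) * cup adj S b $ ((b, a), k)))"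
      unfolding cap_def[of _ _ a "\<chi> p. lift23 _ _ $ (fst p, snd p, k)"]
      by (intro sum.cong) (auto simp: lift23_T_op_nth cap_lift12_T_op S sym)
    also have "\<dots> = (\<Sum>b | adj a b. if b = k\<^sub>2 then
       (if k\<^sub>1 = a then cap adj S a (\<chi> p. \<psi> $ (fst p, snd p, k)) else 0) else 0)"
      unfolding Pair using sym
      by (intro sum.cong) (auto simp: cup_nth cup_weight_inverse[OF S] mult.left_commute)
    also have "\<dots> = cap adj S a (\<chi> p. \<psi> $ (fst p, snd p, k))"
    proof (cases "k\<^sub>1 = a \<and> adj a k\<^sub>2")
      case True
      then show ?thesis by simp
    next
      case False
      then have "\<psi> $ ((a, c), (c, a), (k\<^sub>1, k\<^sub>2)) = 0" for c
        using supp unfolding walk_supported_def by blast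
      with False show ?thesis by (auto simp: cap_def Pair)
    qed
    finally show ?thesis .
  qed
  then show ?thesis
    by (simp add: vec_eq_iff lift12_T_op_nth)
qed

text \<open>
  Dually, only the caps in the last two factors need to be compared, and the support condition
  disposes of the first edges that do not start at \<open>a\<close>.
\<close>

lemma lift23_lift12_lift23:
  assumes S: "\<And>i. S $ i > 0" and sym: "\<And>x y. adj x y \<Longrightarrow> adj y x"
    and supp: "walk_supported adj a \<psi>"
  shows "lift23 (T_op adj S) (lift12 (T_op adj S) a (lift23 (T_op adj S) \<psi>)) = lift23 (T_op adj S) \<psi>"
proof -
  have "cap adj S (snd i) (\<chi> q. lift12 (T_op adj S) a (lift23 (T_op adj S) \<psi>) $ (i, q)) =
    cap adj S (snd i) (\<chi> q. \<psi> $ (i, q))" for i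
  proof (cases "fst i = a \<and> adj a (snd i)")
    case True
    then obtain s where i: "i = (a, s)" and as: "adj a s"
      by (cases i) auto
    have "cap adj S a (\<chi> p. lift23 (T_op adj S) \<psi> $ (fst p, snd p, (a, s))) =
      (\<Sum>b | adj a b. if b = s then cap adj S s (\<chi> q. \<psi> $ ((a, s), q)) else 0)"
      unfolding cap_def[of _ _ a] using as sym
      by (intro sum.cong) (auto simp: lift23_T_op_nth cup_nth cup_weight_inverse[OF S] mult.left_commute)
    then show ?thesis
      using as sym by (simp add: i cap_lift12_T_op[OF S])
  next
    case False
    then have "\<psi> $ (i, q) = 0" for q
      using supp unfolding walk_supported_def by (cases i; cases q) (metis prod.collapse)
    moreover have "lift12 (T_op adj S) a (lift23 (T_op adj S) \<psi>) $ (i, q) = 0" for q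
      using False by (cases i; cases q) (auto simp: lift12_T_op_nth cup_nth)
    ultimately show ?thesis by (simp add: cap_def)
  qed
  then show ?thesis
    by (auto simp: vec_eq_iff lift23_T_op_nth)
qed

section \<open>Baxterization\<close>

definition baxterize :: "(complex ^ 'n \<Rightarrow> complex ^ 'n) \<Rightarrow> complex \<Rightarrow> complex ^ 'n \<Rightarrow> complex ^ 'n" where
  "baxterize F c \<phi> = \<phi> + c *s F \<phi>"

text \<open>
  After expansion, the Temperley--Lieb relations turn the left side into
  \<open>1 + (x + v + \<kappa>xv + xyv) Q + y P + xy QP + yv PQ\<close>, and the right side into the same expression
  with \<open>P\<close> and \<open>Q\<close> exchanged in the two linear terms. The condition on the parameters says precisely
  that both linear terms have the coefficient \<open>y\<close>. The relations are demanded only at the vector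
  \<open>\<psi>\<close>, because the cubic ones fail away from the walks.
\<close>

lemma yang_baxter_of_temperley_lieb:
  assumes P: "Vector_Spaces.linear (*s) (*s) P" and Q: "Vector_Spaces.linear (*s) (*s) Q"
    and sq: "P (P \<psi>) = \<kappa> *s P \<psi>" "Q (Q \<psi>) = \<kappa> *s Q \<psi>"
    and tl: "P (Q (P \<psi>)) = P \<psi>" "Q (P (Q \<psi>)) = Q \<psi>"
    and xyv: "x * (1 + \<kappa> * v + v * y) = y - v"
  shows "baxterize Q x (baxterize P y (baxterize Q v \<psi>)) =
    baxterize P v (baxterize Q y (baxterize P x \<psi>))"
proof -
  have y: "y = x + v + \<kappa> * x * v + x * v * y"
    using xyv by (simp add: algebra_simps)
  note lin = vec.linear_add[OF P] vec.linear_add[OF Q] vec.linear_scale[OF P] vec.linear_scale[OF Q]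
  have "baxterize Q x (baxterize P y (baxterize Q v \<psi>)) =
      \<psi> + (x + v + \<kappa> * x * v + x * v * y) *s Q \<psi> + y *s P \<psi> + (x * y) *s Q (P \<psi>) + (y * v) *s P (Q \<psi>)"
    unfolding baxterize_def by (simp add: lin sq tl vec_eq_iff algebra_simps)
  moreover have "baxterize P v (baxterize Q y (baxterize P x \<psi>)) =
      \<psi> + (x + v + \<kappa> * x * v + x * v * y) *s P \<psi> + y *s Q \<psi> + (x * y) *s Q (P \<psi>) + (y * v) *s P (Q \<psi>)"
    unfolding baxterize_def by (simp add: lin sq tl vec_eq_iff algebra_simps)
  ultimately show ?thesis
    unfolding y[symmetric] by (simp add: algebra_simps)
qed

lemma spectral_parametrization_difference:
  assumes "z \<noteq> 1" "z' \<noteq> 1" "z' - z \<noteq> 1"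
    and x: "x = spectral_parametrization z" "x' = spectral_parametrization z'"
  shows "1 + 2 * x + x * x' \<noteq> 0"
    and "spectral_parametrization (z' - z) = (x' - x) / (1 + 2 * x + x * x')"
proof -
  have nz: "1 - z \<noteq> 0" "1 - z' \<noteq> 0" "1 - (z' - z) \<noteq> 0"
    using assms by auto
  \<comment> \<open>The eigenvalue 2 is what cancels the term \<open>z * z'\<close> in this numerator.\<close>
  have den: "1 + 2 * x + x * x' = (1 - (z' - z)) / ((1 - z) * (1 - z'))"
    using nz by (simp add: x spectral_parametrization_def divide_simps) algebra
  have num: "x' - x = (z' - z) / ((1 - z) * (1 - z'))"
    using nz by (simp add: x spectral_parametrization_def divide_simps) algebra
  show "1 + 2 * x + x * x' \<noteq> 0"
    using nz by (simp add: den)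
  show "spectral_parametrization (z' - z) = (x' - x) / (1 + 2 * x + x * x')"
    using nz unfolding den num by (simp add: spectral_parametrization_def)
qed

lemma lift12_R_check:
  shows "lift12 (R_check adj S z) a = baxterize (lift12 (T_op adj S) a) (spectral_parametrization z)"
  by (auto simp: fun_eq_iff vec_eq_iff baxterize_def lift12_nth linear_T_op linear_R_check)
    (simp add: R_check_def spectral_parametrization_def)

lemma lift23_R_check:
  shows "lift23 (R_check adj S z) = baxterize (lift23 (T_op adj S)) (spectral_parametrization z)"
  by (auto simp: fun_eq_iff vec_eq_iff baxterize_def lift23_nth linear_T_op linear_R_check)
    (simp add: R_check_def spectral_parametrization_def)

theorem proposition2p34:
  fixes adj :: "'v::finite \<Rightarrow> 'v \<Rightarrow> bool"
  assumes "affine_ADE adj"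
  shows "perron_frobenius_eigenvalue (adjacency_matrix adj) = 2 \<and>
    (\<forall>z z' z'' x x' x'' :: complex.
       z'' = z' - z \<and> z \<noteq> 1 \<and> z' \<noteq> 1 \<and> z'' \<noteq> 1 \<and>
       x = spectral_parametrization z \<and> x' = spectral_parametrization z' \<and>
       x'' = spectral_parametrization z'' \<longrightarrow>
         1 + of_real (perron_frobenius_eigenvalue (adjacency_matrix adj)) * x + x * x' \<noteq> 0 \<and>
         x'' = (x' - x) /
           (1 + of_real (perron_frobenius_eigenvalue (adjacency_matrix adj)) * x + x * x')) \<and>
    (\<forall>S. perron_frobenius_eigenvector (adjacency_matrix adj) S \<longrightarrow>
       (\<forall>a z w. z \<noteq> 1 \<and> w \<noteq> 1 \<and> z - w \<noteq> 1 \<longrightarrow>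
         (\<forall>\<psi> \<in> source_fiber adj
             (graded_tensor adj (edge_space adj)
               (graded_tensor adj (edge_space adj) (edge_space adj))) a.
            lift23 (R_check adj S (z - w)) (lift12 (R_check adj S z) a (lift23 (R_check adj S w) \<psi>)) =
            lift12 (R_check adj S w) a (lift23 (R_check adj S z) (lift12 (R_check adj S (z - w)) a \<psi>)))))"
proof -
  have two: "perron_frobenius_eigenvalue (adjacency_matrix adj) = 2"
    using affine_ADE_perron_frobenius[OF assms] .
  have ybe: "lift23 (R_check adj S (z - w)) (lift12 (R_check adj S z) a (lift23 (R_check adj S w) \<psi>)) =
      lift12 (R_check adj S w) a (lift23 (R_check adj S z) (lift12 (R_check adj S (z - w)) a \<psi>))"
    if S: "perron_frobenius_eigenvector (adjacency_matrix adj) S"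
      and nz: "z \<noteq> 1" "w \<noteq> 1" "z - w \<noteq> 1"
      and \<psi>: "\<psi> \<in> source_fiber adj
        (graded_tensor adj (edge_space adj) (graded_tensor adj (edge_space adj) (edge_space adj))) a"
    for S a z w \<psi>
  proof -
    have pos: "\<And>i. S $ i > 0" and eig: "adjacency_matrix adj *v S = 2 *s S"
      using S by (simp_all add: perron_frobenius_eigenvector_def two)
    note supp = source_fiber_walk_supported[OF \<psi>]
    note sym = affine_ADE_symmetric[OF assms]
    note diff = spectral_parametrization_difference[OF nz(2,1,3) refl refl]
    show ?thesis
      unfolding lift12_R_check lift23_R_check
    proof (rule yang_baxter_of_temperley_lieb[OF linear_lift12 linear_lift23])
      show "spectral_parametrization (z - w) *
          (1 + of_real 2 * spectral_parametrization w + spectral_parametrization w * spectral_parametrization z) =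
        spectral_parametrization z - spectral_parametrization w"
        using diff by simp
    qed (use lift12_T_op_square[OF pos eig] lift23_T_op_square[OF pos eig]
        lift12_lift23_lift12[OF pos _ supp] lift23_lift12_lift23[OF pos _ supp] sym in blast)+
  qed
  show ?thesis
    using two ybe spectral_parametrization_difference by simp
qed

end
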